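(* Let $m,\ell$ be coprime integers with $\ell>m$, let $c_1,c_2$ be nonzero real numbers, and let $f(t)=c_1e^{itm}+c_2e^{it\ell}$, $t\in\mathbb{R}$. Suppose that $w_0=f(t_0)=f(s_0)\neq0$ $(t_0\not\equiv s_0\bmod 2\pi)$ is a self-intersection point of the curve $f$, and consider its module class $\{w_k: 0\le k\le \ell-m-1\}$, $w_k=f\big(t_0+\tfrac{2k\pi}{\ell-m}\big)$. Then the elements of the group $G(\ell,m)$ map this module class of self-intersection points onto itself.
   Context: Write $f=x+iy$ with $x,y$ real-valued. The point $w_0=f(t_0)=f(s_0)$ is a self-intersection point of the curve $f$ if the curve has different tangent lines there, i.e. $\dot y(t_0)/\dot x(t_0)\neq\dot y(s_0)/\dot x(s_0)$ (slope $\infty$ allowed when $\dot x=0\ne\dot y$). With $t_k=t_0+2k\pi/(\ell-m)$ and $s_k=s_0+2k\pi/(\ell-m)$, the self-intersection points $w_k=f(t_k)=f(s_k)$, $0\le k\le\ell-m-1$, are said to belong to the same module class. $G(\ell,m)$ is the finite group of rotations of the complex plane whose elements are the multiplications by $g_k=e^{2ik\pi m/(\ell-m)}$, $0\le k\le\ell-m-1$. *)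

theory Defs
  imports "HOL-Analysis.Analysis" "HOL-Algebra.Group" "HOL-Library.Real_Mod"
begin

definition trochoid :: "real \<Rightarrow> real \<Rightarrow> int \<Rightarrow> int \<Rightarrow> real \<Rightarrow> complex" where
  "trochoid c1 c2 m l t =
     complex_of_real c1 * exp (\<i> * complex_of_real (t * real_of_int m)) +
     complex_of_real c2 * exp (\<i> * complex_of_real (t * real_of_int l))"

(* A relation rather than a function: where both derivatives vanish (or one does not exist)
   the slope is undefined. *)
definition has_slope :: "(real \<Rightarrow> complex) \<Rightarrow> real \<Rightarrow> ereal \<Rightarrow> bool" where
  "has_slope f t \<sigma> \<longleftrightarrow>
     (\<exists>x' y'. ((\<lambda>u. Re (f u)) has_real_derivative x') (at t) \<and>
              ((\<lambda>u. Im (f u)) has_real_derivative y') (at t) \<and>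
              (x' \<noteq> 0 \<and> \<sigma> = ereal (y' / x') \<or> x' = 0 \<and> y' \<noteq> 0 \<and> \<sigma> = \<infinity>))"

definition self_intersection_at ::
  "(real \<Rightarrow> complex) \<Rightarrow> complex \<Rightarrow> real \<Rightarrow> real \<Rightarrow> bool" where
  "self_intersection_at f w t s \<longleftrightarrow>
     w = f t \<and> w = f s \<and> (\<exists>\<sigma> \<tau>. has_slope f t \<sigma> \<and> has_slope f s \<tau> \<and> \<sigma> \<noteq> \<tau>)"

definition shifted_param :: "int \<Rightarrow> int \<Rightarrow> real \<Rightarrow> int \<Rightarrow> real" where
  "shifted_param m l t k = t + 2 * real_of_int k * pi / real_of_int (l - m)"

(* Since f(t_k) = f(s_k), the class is determined by either one of the two parameters. *)
definition module_class :: "(real \<Rightarrow> complex) \<Rightarrow> int \<Rightarrow> int \<Rightarrow> real \<Rightarrow> complex set" where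
  "module_class f m l t = (\<lambda>k. f (shifted_param m l t k)) ` {0..l - m - 1}"

definition rotation_factor :: "int \<Rightarrow> int \<Rightarrow> int \<Rightarrow> complex" where
  "rotation_factor l m k =
     exp (2 * \<i> * of_int k * complex_of_real pi * of_int m / of_int (l - m))"

definition rotation_group :: "int \<Rightarrow> int \<Rightarrow> (complex \<Rightarrow> complex) monoid" where
  "rotation_group l m =
     \<lparr>carrier = (\<lambda>k z. rotation_factor l m k * z) ` {0..l - m - 1}, mult = (\<circ>), one = id\<rparr>"

lemma rotation_factor_add:
  "rotation_factor l m (j + k) = rotation_factor l m j * rotation_factor l m k"
  unfolding rotation_factor_def exp_add[symmetric]
  by (simp add: algebra_simps add_divide_distrib)

lemma rotation_factor_period:
  assumes "l > m"
  shows "rotation_factor l m ((l - m) * k) = 1"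
proof -
  define n where "n = l - m"
  have "n \<noteq> 0" using assms by (simp add: n_def)
  then have "2 * \<i> * of_int (n * k) * complex_of_real pi * of_int m / of_int n
     = 2 * complex_of_real pi * \<i> * of_int (k * m)"
    by (simp add: field_simps)
  then show ?thesis
    unfolding rotation_factor_def n_def[symmetric]
    by (auto simp: exp_eq_1 intro!: exI[of _ "k * m"])
qed

lemma rotation_factor_mod:
  assumes "l > m"
  shows "rotation_factor l m (k mod (l - m)) = rotation_factor l m k"
  by (metis assms mod_mult_div_eq mult.right_neutral rotation_factor_add rotation_factor_period)

lemma carrier_rotation_group:
  assumes "l > m"
  shows "carrier (rotation_group l m) = range (\<lambda>k z. rotation_factor l m k * z)"
proof -
  have "(\<lambda>z. rotation_factor l m k * z) \<in> carrier (rotation_group l m)" for k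
    using assms
    by (auto simp: rotation_group_def rotation_factor_mod intro!: image_eqI[of _ _ "k mod (l - m)"])
  then show ?thesis by (auto simp: rotation_group_def)
qed

lemma group_rotation_group:
  assumes "l > m"
  shows "group (rotation_group l m)"
proof (rule groupI)
  note [simp] = carrier_rotation_group[OF assms]
  have rf0: "rotation_factor l m 0 = 1" by (simp add: rotation_factor_def)
  show "\<one>\<^bsub>rotation_group l m\<^esub> \<in> carrier (rotation_group l m)"
  proof -
    have "\<one>\<^bsub>rotation_group l m\<^esub> = (\<lambda>z. rotation_factor l m 0 * z)"
      by (simp add: rotation_group_def rf0 fun_eq_iff)
    then show ?thesis by simp
  qed
  fix g assume g: "g \<in> carrier (rotation_group l m)"
  then obtain j where j: "g = (\<lambda>z. rotation_factor l m j * z)" by auto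
  show "\<one>\<^bsub>rotation_group l m\<^esub> \<otimes>\<^bsub>rotation_group l m\<^esub> g = g"
    by (simp add: rotation_group_def)
  have "rotation_factor l m (- j) * rotation_factor l m j = 1"
    using rf0 rotation_factor_add[of l m "- j" j] by simp
  then have "(\<lambda>z. rotation_factor l m (- j) * z) \<otimes>\<^bsub>rotation_group l m\<^esub> g
      = \<one>\<^bsub>rotation_group l m\<^esub>"
    unfolding j by (auto simp: rotation_group_def fun_eq_iff simp flip: mult.assoc)
  then show "\<exists>h\<in>carrier (rotation_group l m).
      h \<otimes>\<^bsub>rotation_group l m\<^esub> g = \<one>\<^bsub>rotation_group l m\<^esub>"
    by auto
  fix h assume "h \<in> carrier (rotation_group l m)"
  then obtain k where k: "h = (\<lambda>z. rotation_factor l m k * z)" by auto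
  have "g \<otimes>\<^bsub>rotation_group l m\<^esub> h = (\<lambda>z. rotation_factor l m (j + k) * z)"
    unfolding j k by (simp add: rotation_group_def rotation_factor_add fun_eq_iff)
  then show "g \<otimes>\<^bsub>rotation_group l m\<^esub> h \<in> carrier (rotation_group l m)" by simp
next
  fix x y z
  show "x \<otimes>\<^bsub>rotation_group l m\<^esub> y \<otimes>\<^bsub>rotation_group l m\<^esub> z =
        x \<otimes>\<^bsub>rotation_group l m\<^esub> (y \<otimes>\<^bsub>rotation_group l m\<^esub> z)"
    by (simp add: rotation_group_def comp_assoc)
qed

lemma finite_rotation_group: "finite (carrier (rotation_group l m))"
  by (simp add: rotation_group_def)

end

theory Submission
  imports Defs
begin

text \<open>
  Everything rests on one identity. Advancing the parameter by $2k\pi/(\ell-m)$ multiplies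
  $e^{itm}$ by $g_k = e^{2ik\pi m/(\ell-m)}$, and it multiplies $e^{it\ell}$ by the same number,
  because the two phase increments differ by $2k\pi$. Hence $f(t + 2k\pi/(\ell-m)) = g_k f(t)$
  (\<open>trochoid_shifted_param\<close>).

  It follows that the shift carries the curve near $t_0$ and near $s_0$ to its image under one
  common rotation. A rotation maps distinct tangent lines to distinct tangent lines, so the
  shifted parameters again give a self-intersection (\<open>self_intersection_at_shift\<close>). Because a
  slope is a coordinate-dependent quantity that may be infinite, distinctness of the tangent
  lines is first expressed by the cross product of the two velocity vectors
  (\<open>distinct_slopes_iff\<close>), which a common complex factor $g$ scales by $|g|^2$.

  It also follows that the module class is the orbit of $w_0$ under the rotation group
  (\<open>module_class_trochoid\<close>), and a group maps each of its orbits onto itself.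
\<close>

lemma has_slope_iff:
  "has_slope f t \<sigma> \<longleftrightarrow>
     (\<exists>d. (f has_vector_derivative d) (at t) \<and>
          (Re d \<noteq> 0 \<and> \<sigma> = ereal (Im d / Re d) \<or> Re d = 0 \<and> Im d \<noteq> 0 \<and> \<sigma> = \<infinity>))"
  (is "_ \<longleftrightarrow> ?R")
proof
  assume "has_slope f t \<sigma>"
  then obtain x' y' where
    "((\<lambda>u. Re (f u)) has_real_derivative x') (at t)"
    "((\<lambda>u. Im (f u)) has_real_derivative y') (at t)"
    "x' \<noteq> 0 \<and> \<sigma> = ereal (y' / x') \<or> x' = 0 \<and> y' \<noteq> 0 \<and> \<sigma> = \<infinity>"
    unfolding has_slope_def by blast
  then show ?R
    by (intro exI[of _ "Complex x' y'"]) (simp add: has_vector_derivative_complex_iff)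
next
  assume ?R
  then show "has_slope f t \<sigma>"
    unfolding has_slope_def has_vector_derivative_complex_iff by blast
qed

text \<open>
  \<open>Im (cnj d * e)\<close> is the cross product \<open>Re d * Im e - Im d * Re e\<close>. It is nonzero exactly when
  the two velocities span different lines, and then neither velocity vanishes, so
  both slopes exist. This covers vertical tangents without a separate case.
\<close>

lemma distinct_slopes_iff:
  "(\<exists>\<sigma> \<tau>. has_slope f t \<sigma> \<and> has_slope f s \<tau> \<and> \<sigma> \<noteq> \<tau>) \<longleftrightarrow>
   (\<exists>d e. (f has_vector_derivative d) (at t) \<and> (f has_vector_derivative e) (at s) \<and>
          Im (cnj d * e) \<noteq> 0)"
  (is "?L \<longleftrightarrow> ?R")
proof
  assume ?L
  then obtain d e \<sigma> \<tau> where
    "(f has_vector_derivative d) (at t)" "(f has_vector_derivative e) (at s)"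
    "Re d \<noteq> 0 \<and> \<sigma> = ereal (Im d / Re d) \<or> Re d = 0 \<and> Im d \<noteq> 0 \<and> \<sigma> = \<infinity>"
    "Re e \<noteq> 0 \<and> \<tau> = ereal (Im e / Re e) \<or> Re e = 0 \<and> Im e \<noteq> 0 \<and> \<tau> = \<infinity>"
    "\<sigma> \<noteq> \<tau>"
    unfolding has_slope_iff by blast
  moreover from this have "Im (cnj d * e) \<noteq> 0"
    by (auto simp: field_simps)
  ultimately show ?R by blast
next
  assume ?R
  then obtain d e where
    de: "(f has_vector_derivative d) (at t)" "(f has_vector_derivative e) (at s)"
    and cross: "Re d * Im e \<noteq> Im d * Re e"
    by auto
  define slope where "slope v = (if Re v = 0 then \<infinity> else ereal (Im v / Re v))" for v :: complex
  have "has_slope f t (slope d)" "has_slope f s (slope e)"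
    unfolding has_slope_iff slope_def using de cross by (metis mult_eq_0_iff)+
  moreover have "slope d \<noteq> slope e"
    using cross by (auto simp: slope_def field_simps)
  ultimately show ?L by blast
qed

lemma has_vector_derivative_shift_mult:
  fixes f :: "real \<Rightarrow> complex"
  assumes sym: "\<And>u. f (u + h) = g * f u"
    and d: "(f has_vector_derivative d) (at t)"
  shows "(f has_vector_derivative g * d) (at (t + h))"
proof -
  have "((\<lambda>u. u - h) has_vector_derivative 1) (at (t + h))"
    using has_vector_derivative_diff[OF has_vector_derivative_id has_vector_derivative_const] by simp
  then have "((\<lambda>u. g * f (u - h)) has_vector_derivative g * d) (at (t + h))"
    using vector_diff_chain_at[of "\<lambda>u. u - h" 1 "t + h" f d] d
    by (intro has_vector_derivative_mult_right) (simp add: o_def)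
  moreover have "(\<lambda>u. g * f (u - h)) = f"
    by (simp flip: sym)
  ultimately show ?thesis by simp
qed

text \<open>
  Both velocities are multiplied by the same \<open>g\<close>, which multiplies their cross product by
  \<open>cnj g * g\<close>, a positive real number.
\<close>

lemma self_intersection_at_shift:
  assumes sym: "\<And>u. f (u + h) = g * f u" and "g \<noteq> 0"
    and inter: "self_intersection_at f w t s"
  shows "self_intersection_at f (g * w) (t + h) (s + h)"
proof -
  obtain d e where
    d: "(f has_vector_derivative d) (at t)" and e: "(f has_vector_derivative e) (at s)"
    and cross: "Im (cnj d * e) \<noteq> 0"
    using inter unfolding self_intersection_at_def distinct_slopes_iff by blast
  have "cnj (g * d) * (g * e) = complex_of_real ((cmod g)\<^sup>2) * (cnj d * e)"
    by (simp only: complex_norm_square complex_cnj_mult mult_ac)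
  then have "Im (cnj (g * d) * (g * e)) = (cmod g)\<^sup>2 * Im (cnj d * e)"
    by (simp only: scaleR_conv_of_real[symmetric] scaleR_complex.sel)
  then have "Im (cnj (g * d) * (g * e)) \<noteq> 0"
    using cross \<open>g \<noteq> 0\<close> by (metis mult_eq_0_iff norm_eq_zero power_not_zero)
  moreover have "(f has_vector_derivative g * d) (at (t + h))"
    "(f has_vector_derivative g * e) (at (s + h))"
    by (intro has_vector_derivative_shift_mult sym d e)+
  ultimately show ?thesis
    using inter sym unfolding self_intersection_at_def distinct_slopes_iff by metis
qed

lemma trochoid_shifted_param:
  assumes "l > m"
  shows "trochoid c1 c2 m l (shifted_param m l t k) =
         rotation_factor l m k * trochoid c1 c2 m l t"
proof -
  define n where "n = l - m"
  have n: "n \<noteq> 0" and l: "l = m + n" using assms by (auto simp: n_def)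
  let ?h = "2 * real_of_int k * pi / real_of_int n"
  have m_phase: "exp (\<i> * complex_of_real ((t + ?h) * real_of_int m)) =
    rotation_factor l m k * exp (\<i> * complex_of_real (t * real_of_int m))"
    unfolding rotation_factor_def exp_add[symmetric] n_def[symmetric]
    by (rule arg_cong[of _ _ exp]) (simp add: algebra_simps)
  \<comment> \<open>Relative to the phase with frequency $m$, the shift adds $(\ell - m) \cdot 2k\pi/(\ell-m)$:
    $k$ full turns.\<close>
  have "exp (\<i> * complex_of_real ((t + ?h) * real_of_int l)) =
    exp (\<i> * complex_of_real ((t + ?h) * real_of_int m) +
         \<i> * complex_of_real (t * real_of_int n) + 2 * of_int k * complex_of_real pi * \<i>)"
    unfolding l using n by (intro arg_cong[of _ _ exp]) (simp add: field_simps)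
  also have "\<dots> = exp (\<i> * complex_of_real ((t + ?h) * real_of_int m)) *
         exp (\<i> * complex_of_real (t * real_of_int n))"
    using exp_integer_2pi[of "of_int k"] by (simp add: exp_add mult_ac)
  also have "\<dots> = rotation_factor l m k * exp (\<i> * complex_of_real (t * real_of_int l))"
    unfolding m_phase unfolding mult.assoc exp_add[symmetric] by (simp add: l algebra_simps)
  finally show ?thesis
    using m_phase
    by (simp add: trochoid_def shifted_param_def n_def[symmetric] algebra_simps)
qed

lemma module_class_trochoid:
  assumes "l > m"
  shows "module_class (trochoid c1 c2 m l) m l t =
         (\<lambda>g. g (trochoid c1 c2 m l t)) ` carrier (rotation_group l m)"
  by (simp add: module_class_def rotation_group_def image_image trochoid_shifted_param[OF assms])

text \<open>
  Composing with a fixed rotation permutes the rotation group, hence the orbit.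
\<close>

lemma rotation_group_image_orbit:
  assumes "l > m" and g: "g \<in> carrier (rotation_group l m)"
  shows "g ` ((\<lambda>h. h w) ` carrier (rotation_group l m)) =
         (\<lambda>h. h w) ` carrier (rotation_group l m)"
proof -
  interpret group "rotation_group l m" by (rule group_rotation_group[OF assms(1)])
  have "g ` ((\<lambda>h. h w) ` carrier (rotation_group l m)) =
        (\<lambda>h. h w) ` ((\<lambda>h. g \<otimes>\<^bsub>rotation_group l m\<^esub> h) ` carrier (rotation_group l m))"
    by (simp add: image_image rotation_group_def)
  also have "(\<lambda>h. g \<otimes>\<^bsub>rotation_group l m\<^esub> h) ` carrier (rotation_group l m) =
        carrier (rotation_group l m)"
    using g by (rule surj_const_mult)
  finally show ?thesis .
qed

theorem theorem5p12:
  fixes m l :: int and c1 c2 t0 s0 :: real and w0 :: complex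
    and f :: "real \<Rightarrow> complex"
  assumes "coprime m l" and "l > m"
    and "c1 \<noteq> 0" and "c2 \<noteq> 0"
    and f_def: "f = trochoid c1 c2 m l"
    and "\<not> [t0 = s0] (rmod 2 * pi)"
    and "self_intersection_at f w0 t0 s0"
    and "w0 \<noteq> 0"
  shows "(\<forall>k \<in> {0..l - m - 1}.
            self_intersection_at f (f (shifted_param m l t0 k))
              (shifted_param m l t0 k) (shifted_param m l s0 k)) \<and>
         (\<forall>g \<in> carrier (rotation_group l m). g ` module_class f m l t0 = module_class f m l t0)"
proof (intro conjI ballI)
  fix k
  have shift: "f (shifted_param m l u k) = rotation_factor l m k * f u" for u
    unfolding f_def by (rule trochoid_shifted_param[OF \<open>l > m\<close>])
  have "rotation_factor l m k \<noteq> 0"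
    by (simp add: rotation_factor_def)
  moreover have "w0 = f t0"
    using assms(7) by (simp add: self_intersection_at_def)
  ultimately show "self_intersection_at f (f (shifted_param m l t0 k))
      (shifted_param m l t0 k) (shifted_param m l s0 k)"
    using self_intersection_at_shift[OF shift[unfolded shifted_param_def] _ assms(7)]
    by (simp add: shift) (simp add: shifted_param_def)
next
  fix g assume "g \<in> carrier (rotation_group l m)"
  then show "g ` module_class f m l t0 = module_class f m l t0"
    unfolding f_def module_class_trochoid[OF \<open>l > m\<close>]
    by (rule rotation_group_image_orbit[OF \<open>l > m\<close>])
qed

end
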